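(* Let $n \ge 1$ and $k \geq 1$ be integers, and let $\mathcal{M}_k(K_n)$ be the set of ordered matchings of size $k$ in the complete graph $K_n$. A universal cycle for $\mathcal{M}_k(K_n)$ exists except when $n \ge 4$ is even and $k = \frac{n}{2}$, in which case no universal cycle for $\mathcal{M}_k(K_n)$ exists. In other words, universal cycles for the ordered matchings of size $k$ in the complete graph exist except when they are perfect matchings with more than one edge.
   Context: $K_n$ is the complete graph on vertex set $\{0,1,\ldots,n-1\}$. An ordered matching of size $k$ in an undirected graph $G$ is an ordered list $[e_1,e_2,\ldots,e_k]$ of $k$ distinct undirected edges of $G$ such that $\{e_1,\ldots,e_k\}$ is a matching (the edges are pairwise vertex-disjoint). $\mathcal{M}_k(G)$ is the set of all ordered matchings of size $k$ in $G$. A universal cycle of $\mathcal{M}_k(G)$ is a cyclic sequence $c_0 c_1 \cdots c_{N-1}$ of edges of $G$ of length $N = |\mathcal{M}_k(G)|$ (indices modulo $N$) such that every $L \in \mathcal{M}_k(G)$ occurs exactly once as a list of $k$ consecutive terms $[c_i, c_{i+1},\ldots,c_{i+k-1}]$, $0 \le i < N$. Each edge is an unordered indivisible symbol. If $\mathcal{M}_k(G) = \emptyset$, the empty sequence counts as a universal cycle. *)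

theory Defs
  imports Main "HOL-Library.Ramsey"
begin

text \<open>
  An undirected simple graph is a pair of its vertex set and its edge set, where an edge is the
  two-element set of its endpoints.
\<close>
type_synonym 'a ugraph = "'a set \<times> 'a set set"

abbreviation vertices :: "'a ugraph \<Rightarrow> 'a set" where
  "vertices G \<equiv> fst G"

abbreviation edges :: "'a ugraph \<Rightarrow> 'a set set" where
  "edges G \<equiv> snd G"

definition complete_graph :: "nat \<Rightarrow> nat ugraph" where
  "complete_graph n = ({0..<n}, nsets {0..<n} 2)"

definition matching :: "'a ugraph \<Rightarrow> 'a set set \<Rightarrow> bool" where
  "matching G M \<longleftrightarrow> M \<subseteq> edges G \<and> pairwise disjnt M"

definition ordered_matchings :: "nat \<Rightarrow> 'a ugraph \<Rightarrow> 'a set list set" where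
  "ordered_matchings k G = {es. length es = k \<and> distinct es \<and> matching G (set es)}"

text \<open>
  The window of \<open>k\<close> consecutive terms starting at position \<open>i\<close>, with indices taken modulo the
  length. It is only used for \<open>i < length c\<close>, so \<open>c\<close> is never empty there.
\<close>
definition cyclic_window :: "'b list \<Rightarrow> nat \<Rightarrow> nat \<Rightarrow> 'b list" where
  "cyclic_window c k i = map (\<lambda>j. c ! ((i + j) mod length c)) [0..<k]"

text \<open>
  If there are no ordered matchings of size \<open>k\<close>, then exactly the empty sequence is a universal
  cycle.
\<close>
definition universal_cycle :: "nat \<Rightarrow> 'a ugraph \<Rightarrow> 'a set list \<Rightarrow> bool" where
  "universal_cycle k G c \<longleftrightarrow>
     length c = card (ordered_matchings k G) \<and>
     set c \<subseteq> edges G \<and>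
     (\<forall>L \<in> ordered_matchings k G. \<exists>!i. i < length c \<and> cyclic_window c k i = L)"

end

theory Submission
  imports Defs "Graph_Theory.Euler"
begin

text \<open>
  Take the ordered matchings of size \<open>k\<close> as arcs of a digraph, an arc leading from its first \<open>k - 1\<close>
  edges to its last \<open>k - 1\<close> edges. Universal cycles are Euler circuits of this digraph, and rotation
  of lists shows that it is balanced, so only connectedness matters. Rotating around once and
  changing one edge on the way replaces that edge in place. If \<open>2k < n\<close>, then a matching, seen as an
  injective labelling of \<open>2k\<close> endpoints, leaves some vertex unused, and moving an unused vertex to an
  endpoint is such a replacement; these moves reach every labelling, as star transpositions generate
  the symmetric group. If \<open>n = 2k \<ge> 4\<close>, the edge following \<open>k - 1\<close> given ones is forced, so all windows
  of a universal cycle contain the same edges, although there are different perfect matchings.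
\<close>

section \<open>Euler circuits and universal cycles\<close>

text \<open>Adjacency between arcs of the digraph below: \<open>M\<close> may directly follow
  \<open>L\<close> on a walk. Relating arcs instead of vertices keeps later arguments on whole
  matchings.\<close>

definition succ_rel :: "nat \<Rightarrow> 'a ugraph \<Rightarrow> ('a set list \<times> 'a set list) set" where
  "succ_rel k G = {(L, M). L \<in> ordered_matchings k G \<and> M \<in> ordered_matchings k G \<and> tl L = butlast M}"

text \<open>An analogue of the de Bruijn graph. Only initial segments of ordered matchings are
  vertices, so every vertex has an outgoing arc.\<close>

definition transition_digraph :: "nat \<Rightarrow> 'a ugraph \<Rightarrow> ('a set list, 'a set list) pre_digraph" where
  "transition_digraph k G =
     \<lparr>verts = butlast ` ordered_matchings k G, arcs = ordered_matchings k G, tail = butlast, head = tl\<rparr>"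

lemma transition_digraph_simps [simp]:
  "verts (transition_digraph k G) = butlast ` ordered_matchings k G"
  "arcs (transition_digraph k G) = ordered_matchings k G"
  "tail (transition_digraph k G) = butlast"
  "head (transition_digraph k G) = tl"
  by (simp_all add: transition_digraph_def)

lemma length_ordered_matching: "L \<in> ordered_matchings k G \<Longrightarrow> length L = k"
  by (simp add: ordered_matchings_def)

lemma rotate1_ordered_matching: "rotate1 L \<in> ordered_matchings k G \<longleftrightarrow> L \<in> ordered_matchings k G"
  by (simp add: ordered_matchings_def)

lemma rotate_ordered_matching: "rotate m L \<in> ordered_matchings k G \<longleftrightarrow> L \<in> ordered_matchings k G"
  by (simp add: ordered_matchings_def)

lemma butlast_rotate1: "butlast (rotate1 xs) = tl xs"
  by (cases xs) simp_all

lemma tl_image_ordered_matchings: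
  "tl L \<in> butlast ` ordered_matchings k G" if "L \<in> ordered_matchings k G"
  using that by (metis butlast_rotate1 image_eqI rotate1_ordered_matching)

lemma fin_digraph_transition:
  assumes "finite (ordered_matchings k G)"
  shows "fin_digraph (transition_digraph k G)"
proof unfold_locales
  fix L assume "L \<in> arcs (transition_digraph k G)"
  then show "head (transition_digraph k G) L \<in> verts (transition_digraph k G)"
    by (simp only: transition_digraph_simps tl_image_ordered_matchings)
qed (simp_all add: assms)

text \<open>\<open>rotate1\<close> maps the arcs entering \<open>u\<close> bijectively onto the arcs
  leaving \<open>u\<close>: the edge dropped in front returns at the end.\<close>

lemma in_degree_transition:
  "in_degree (transition_digraph k G) u = out_degree (transition_digraph k G) u"
proof -
  have "bij_betw rotate1 {L \<in> ordered_matchings k G. tl L = u} {L \<in> ordered_matchings k G. butlast L = u}"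
  proof (rule bij_betw_imageI)
    show "inj_on rotate1 {L \<in> ordered_matchings k G. tl L = u}"
      by (metis inj_onI inj_rotate1 injD)
    show "rotate1 ` {L \<in> ordered_matchings k G. tl L = u} = {L \<in> ordered_matchings k G. butlast L = u}"
    proof (intro equalityI subsetI)
      fix L assume "L \<in> {L \<in> ordered_matchings k G. butlast L = u}"
      moreover obtain M where "L = rotate1 M"
        by (metis surj_rotate1 surjD)
      ultimately show "L \<in> rotate1 ` {L \<in> ordered_matchings k G. tl L = u}"
        by (auto simp: rotate1_ordered_matching butlast_rotate1)
    qed (auto simp: rotate1_ordered_matching butlast_rotate1)
  qed
  then show ?thesis
    by (simp add: in_degree_def out_degree_def in_arcs_def out_arcs_def bij_betw_same_card)
qed

text \<open>A step from \<open>M\<close> to \<open>N\<close> is realised by the arc \<open>M\<close>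
  itself, which leads from \<open>butlast M\<close> to \<open>tl M\<close>, that is, to
  \<open>butlast N\<close>.\<close>

lemma succ_rel_rtrancl_reachable:
  assumes "finite (ordered_matchings k G)" "L \<in> ordered_matchings k G" "(L, M) \<in> (succ_rel k G)\<^sup>*"
  shows "butlast L \<rightarrow>\<^sup>*\<^bsub>transition_digraph k G\<^esub> butlast M"
proof -
  interpret fin_digraph "transition_digraph k G"
    using assms(1) by (rule fin_digraph_transition)
  show ?thesis
    using assms(3)
  proof (induction rule: rtrancl_induct)
    case base
    then show ?case using assms(2) by simp
  next
    case (step M N)
    then have "butlast M \<rightarrow>\<^bsub>transition_digraph k G\<^esub> butlast N"
      by (intro dominatesI[of M]) (auto simp: arc_to_ends_def succ_rel_def)
    with step.IH show ?case by (rule reachable_adj_trans)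
  qed
qed

section \<open>Closed walks as cyclic sequences of overlapping lists\<close>

lemma (in pre_digraph) cas_nth_Suc:
  "cas u p v \<Longrightarrow> Suc i < length p \<Longrightarrow> head G (p ! i) = tail G (p ! Suc i)"
proof (induction p arbitrary: u i)
  case (Cons e p)
  then show ?case by (cases i; cases p) auto
qed simp

lemma (in pre_digraph) cas_last: "cas u p v \<Longrightarrow> p \<noteq> [] \<Longrightarrow> head G (last p) = v"
  by (induction p arbitrary: u) auto

lemma (in pre_digraph) closed_cas_nth:
  assumes "cas u p u" "i < length p"
  shows "head G (p ! i) = tail G (p ! (Suc i mod length p))"
proof (cases "Suc i < length p")
  case True
  then show ?thesis using assms cas_nth_Suc by simp
next
  case False
  with assms(2) have *: "Suc i = length p" "p \<noteq> []" by auto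
  moreover have "tail G (p ! 0) = u" using assms(1) * by (cases p) auto
  moreover have "p ! i = last p" using * by (metis last_conv_nth diff_Suc_1)
  ultimately show ?thesis using cas_last[OF assms(1)] by simp
qed

text \<open>By the overlap, position \<open>j + 1\<close> of one list is position \<open>j\<close>
  of the next, so going on by \<open>j\<close> lists brings the entry to the front. Hence the heads
  alone determine the sequence.\<close>

lemma overlapping_nth:
  assumes len: "\<And>i. i < length p \<Longrightarrow> length (p ! i) = k"
    and overlap: "\<And>i. i < length p \<Longrightarrow> tl (p ! i) = butlast (p ! (Suc i mod length p))"
    and "i < length p" "j < k"
  shows "p ! i ! j = hd (p ! ((i + j) mod length p))"
  using assms(3,4)
proof (induction j arbitrary: i)
  case 0
  then have "p ! i \<noteq> []" using len by fastforce
  then show ?case using 0 by (simp add: hd_conv_nth)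
next
  case (Suc j)
  let ?i = "Suc i mod length p"
  have i': "?i < length p" using Suc.prems by (intro mod_less_divisor) linarith
  have "p ! i ! Suc j = tl (p ! i) ! j"
    using Suc.prems len by (simp add: nth_tl)
  also have "\<dots> = p ! ?i ! j"
    using overlap[OF Suc.prems(1)] Suc.prems(2) len[OF i'] by (simp add: nth_butlast)
  also have "\<dots> = hd (p ! ((?i + j) mod length p))"
    using Suc.IH[OF i'] Suc.prems by simp
  finally show ?case by (simp add: mod_simps)
qed

lemma universal_cycle_if_connected:
  fixes G :: "'a ugraph"
  assumes fin: "finite (ordered_matchings k G)" and k: "k \<ge> 1"
    and nonempty: "ordered_matchings k G \<noteq> {}"
    and conn: "\<And>L M. L \<in> ordered_matchings k G \<Longrightarrow> M \<in> ordered_matchings k G \<Longrightarrow> (L, M) \<in> (succ_rel k G)\<^sup>*"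
  shows "\<exists>c. universal_cycle k G c"
proof -
  let ?D = "transition_digraph k G"
  interpret fin_digraph ?D using fin by (rule fin_digraph_transition)
  have "strongly_connected ?D"
    using nonempty by (intro strongly_connectedI) (auto intro!: succ_rel_rtrancl_reachable fin conn)
  then have "connected ?D"
    by (auto simp: connected_def strongly_connected_def intro: reachable_mk_symmetricI)
  then obtain u p where p: "euler_trail u p u"
    using closed_euler in_degree_transition by metis
  then have dist: "distinct p" and set_p: "set p = ordered_matchings k G" and cas: "cas u p u"
    by (auto simp: euler_trail_def trail_def awalk_def)
  have len: "length (p ! i) = k" if "i < length p" for i
    using that set_p by (metis length_ordered_matching nth_mem)
  have window: "cyclic_window (map hd p) k i = p ! i" if i: "i < length p" for i
  proof (rule nth_equalityI)
    fix j assume "j < length (cyclic_window (map hd p) k i)"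
    then have j: "j < k" by (simp add: cyclic_window_def)
    have "(i + j) mod length p < length p" using i by (intro mod_less_divisor) linarith
    then have "cyclic_window (map hd p) k i ! j = hd (p ! ((i + j) mod length p))"
      using j by (simp add: cyclic_window_def)
    also have "\<dots> = p ! i ! j"
      using overlapping_nth[of p k i j] closed_cas_nth[OF cas] i j len by simp
    finally show "cyclic_window (map hd p) k i ! j = p ! i ! j" .
  qed (simp add: cyclic_window_def len i)
  \<comment> \<open>The cycle collects the first edges along the Euler circuit, and its windows are
    the arcs in order. A position exists because the circuit uses every arc; it is unique because no
    arc is used twice.\<close>
  have "universal_cycle k G (map hd p)"
    unfolding universal_cycle_def
  proof (intro conjI ballI)
    show "length (map hd p) = card (ordered_matchings k G)"
      using dist set_p distinct_card by fastforce
    show "set (map hd p) \<subseteq> edges G"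
    proof
      fix e assume "e \<in> set (map hd p)"
      then obtain L where L: "L \<in> ordered_matchings k G" "e = hd L" using set_p by auto
      then have "L \<noteq> []" using k length_ordered_matching by fastforce
      then show "e \<in> edges G"
        using L by (auto simp: ordered_matchings_def matching_def)
    qed
    fix L assume "L \<in> ordered_matchings k G"
    then obtain i where i: "i < length p" "p ! i = L" using set_p by (metis in_set_conv_nth)
    then show "\<exists>!i. i < length (map hd p) \<and> cyclic_window (map hd p) k i = L"
      using window dist by (intro ex1I[of _ i]) (auto simp: nth_eq_iff_index_eq)
  qed
  then show ?thesis ..
qed

section \<open>Replacing edges in place\<close>

lemma rotate_succ_rel:
  assumes "L \<in> ordered_matchings k G"
  shows "(L, rotate m L) \<in> (succ_rel k G)\<^sup>*"
proof (induction m)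
  case (Suc m)
  have "(rotate m L, rotate (Suc m) L) \<in> succ_rel k G"
    using assms
    by (simp add: succ_rel_def rotate_ordered_matching rotate1_ordered_matching butlast_rotate1)
  with Suc show ?case by (rule rtrancl_into_rtrancl)
qed simp

lemma replace_succ_rel:
  assumes L: "L \<in> ordered_matchings k G" and i: "i < k" and M: "L[i := e] \<in> ordered_matchings k G"
  shows "(L, L[i := e]) \<in> (succ_rel k G)\<^sup>*"
proof -
  let ?M = "L[i := e]"
  have len: "length L = k" using L by (rule length_ordered_matching)
  \<comment> \<open>After \<open>i\<close> rotations the edge to be replaced stands in front, the
    only place where the two lists can differ. Dropping it and appending \<open>e\<close> gives
    \<open>?M\<close> rotated \<open>Suc i\<close> times; \<open>k - Suc i\<close> further rotations
    restore the order.\<close>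
  have "tl (rotate i L) = tl (rotate i ?M)"
    using i len by (simp add: rotate_drop_take list_update_beyond flip: Cons_nth_drop_Suc)
  then have "(rotate i L, rotate (Suc i) ?M) \<in> succ_rel k G"
    using L M by (simp add: succ_rel_def rotate_ordered_matching rotate1_ordered_matching butlast_rotate1)
  moreover have "(rotate (Suc i) ?M, rotate (k - Suc i) (rotate (Suc i) ?M)) \<in> (succ_rel k G)\<^sup>*"
    using M by (intro rotate_succ_rel) (simp only: rotate_ordered_matching)
  moreover have "rotate (k - Suc i) (rotate (Suc i) ?M) = ?M"
    using i len by (simp add: rotate_rotate del: rotate_Suc)
  ultimately show ?thesis
    using rotate_succ_rel[OF L, of i] by (metis rtrancl_into_rtrancl rtrancl_trans)
qed

section \<open>Ordered matchings as labellings of endpoints\<close>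

text \<open>The representation is not unique: exchanging the labels at \<open>2 * i\<close> and
  \<open>2 * i + 1\<close> gives the same list.\<close>

definition labelled :: "nat \<Rightarrow> (nat \<Rightarrow> 'a) \<Rightarrow> 'a set list" where
  "labelled k f = map (\<lambda>i. {f (2 * i), f (2 * i + 1)}) [0..<k]"

definition labelling :: "nat \<Rightarrow> nat \<Rightarrow> (nat \<Rightarrow> nat) \<Rightarrow> bool" where
  "labelling n k f \<longleftrightarrow> inj_on f {..<2 * k} \<and> f ` {..<2 * k} \<subseteq> {0..<n}"

lemma length_labelled [simp]: "length (labelled k f) = k"
  by (simp add: labelled_def)

lemma nth_labelled [simp]: "i < k \<Longrightarrow> labelled k f ! i = {f (2 * i), f (2 * i + 1)}"
  by (simp add: labelled_def)

text \<open>Disjointness at different positions already yields distinctness, since an edge is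
  nonempty and so not disjoint from itself.\<close>

lemma ordered_matchings_nth_iff:
  "L \<in> ordered_matchings k (complete_graph n) \<longleftrightarrow>
     length L = k \<and> (\<forall>i<k. L ! i \<in> nsets {0..<n} 2) \<and> (\<forall>i<k. \<forall>j<k. i \<noteq> j \<longrightarrow> disjnt (L ! i) (L ! j))"
proof
  assume L: "L \<in> ordered_matchings k (complete_graph n)"
  then show "length L = k \<and> (\<forall>i<k. L ! i \<in> nsets {0..<n} 2) \<and>
      (\<forall>i<k. \<forall>j<k. i \<noteq> j \<longrightarrow> disjnt (L ! i) (L ! j))"
    by (auto simp: ordered_matchings_def matching_def complete_graph_def pairwise_def
        nth_eq_iff_index_eq)
next
  assume R: "length L = k \<and> (\<forall>i<k. L ! i \<in> nsets {0..<n} 2) \<and>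
      (\<forall>i<k. \<forall>j<k. i \<noteq> j \<longrightarrow> disjnt (L ! i) (L ! j))"
  have "distinct L"
    unfolding distinct_conv_nth
  proof (intro allI impI notI)
    fix i j assume ij: "i < length L" "j < length L" "i \<noteq> j" "L ! i = L ! j"
    then have "disjnt (L ! i) (L ! i)" "L ! i \<in> nsets {0..<n} 2" using R by metis+
    then show False by (auto simp: nsets_def)
  qed
  moreover have "pairwise disjnt (set L)"
    using R by (metis (no_types, lifting) in_set_conv_nth pairwiseI)
  moreover have "set L \<subseteq> nsets {0..<n} 2"
    using R by (auto simp: in_set_conv_nth)
  ultimately show "L \<in> ordered_matchings k (complete_graph n)"
    using R by (simp add: ordered_matchings_def matching_def complete_graph_def)
qed

lemma ordered_matchings_complete_graph:
  "L \<in> ordered_matchings k (complete_graph n) \<longleftrightarrow> (\<exists>f. labelling n k f \<and> L = labelled k f)"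
proof
  assume "L \<in> ordered_matchings k (complete_graph n)"
  then have len: "length L = k" and mem: "\<And>i. i < k \<Longrightarrow> L ! i \<in> nsets {0..<n} 2"
    and disj: "\<And>i j. i < k \<Longrightarrow> j < k \<Longrightarrow> i \<noteq> j \<Longrightarrow> disjnt (L ! i) (L ! j)"
    by (simp_all add: ordered_matchings_nth_iff)
  have "\<forall>i. \<exists>a b. i < k \<longrightarrow> L ! i = {a, b} \<and> a \<noteq> b"
    using mem by (auto simp: nsets_def card_2_iff)
  then obtain a b where ab: "\<And>i. i < k \<Longrightarrow> L ! i = {a i, b i} \<and> a i \<noteq> b i"
    by metis
  \<comment> \<open>Interleaves the chosen endpoints: \<open>a\<close> on even positions,
    \<open>b\<close> on odd ones.\<close>
  define f where "f j = (if even j then a else b) (j div 2)" for j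
  have f_mem: "f j \<in> L ! (j div 2)" if "j < 2 * k" for j
    using ab[of "j div 2"] that by (auto simp: f_def)
  have "inj_on f {..<2 * k}"
  proof (rule inj_onI)
    fix i j assume ij: "i \<in> {..<2 * k}" "j \<in> {..<2 * k}" "f i = f j"
    \<comment> \<open>A shared label is a vertex common to two edges, so these are the same edge;
      its endpoints differ, so the parities agree as well.\<close>
    then have "i div 2 < k" "j div 2 < k" "\<not> disjnt (L ! (i div 2)) (L ! (j div 2))"
      using f_mem[of i] f_mem[of j] by (auto simp: disjnt_def)
    then have same: "i div 2 = j div 2" and "a (j div 2) \<noteq> b (j div 2)"
      using disj ab by blast+
    with ij(3) have "even i \<longleftrightarrow> even j"
      by (cases "even i"; cases "even j") (simp_all add: f_def)
    with same show "i = j" by (metis div_mult_mod_eq mod2_eq_if)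
  qed
  moreover have "f ` {..<2 * k} \<subseteq> {0..<n}"
  proof
    fix v assume "v \<in> f ` {..<2 * k}"
    then obtain j where j: "j < 2 * k" "v = f j" by auto
    then have "L ! (j div 2) \<subseteq> {0..<n}" using mem[of "j div 2"] by (simp add: nsets_def)
    then show "v \<in> {0..<n}" using f_mem j by blast
  qed
  moreover have "L = labelled k f"
    using ab len by (intro nth_equalityI) (auto simp: f_def)
  ultimately show "\<exists>f. labelling n k f \<and> L = labelled k f"
    by (auto simp: labelling_def)
next
  assume "\<exists>f. labelling n k f \<and> L = labelled k f"
  then obtain f where inj: "inj_on f {..<2 * k}" and ran: "f ` {..<2 * k} \<subseteq> {0..<n}"
    and L: "L = labelled k f"
    by (auto simp: labelling_def)
  have eq: "f i = f j \<longleftrightarrow> i = j" if "i < 2 * k" "j < 2 * k" for i j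
    using inj that by (auto simp: inj_on_def)
  have "L ! i \<in> nsets {0..<n} 2" if "i < k" for i
    using that ran[THEN subsetD, OF imageI, of "2 * i"] ran[THEN subsetD, OF imageI, of "2 * i + 1"]
      eq[of "2 * i" "2 * i + 1"]
    by (simp add: L nsets_def)
  moreover have "disjnt (L ! i) (L ! j)" if "i < k" "j < k" "i \<noteq> j" for i j
    using that by (auto simp: L disjnt_def eq)
  ultimately show "L \<in> ordered_matchings k (complete_graph n)"
    by (simp add: ordered_matchings_nth_iff L)
qed

lemma Union_labelled: "\<Union> (set (labelled k f)) = f ` {..<2 * k}"
proof
  show "f ` {..<2 * k} \<subseteq> \<Union> (set (labelled k f))"
  proof
    fix v assume "v \<in> f ` {..<2 * k}"
    then obtain j where j: "j < 2 * k" "v = f j" by auto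
    have "j = 2 * (j div 2) \<or> j = 2 * (j div 2) + 1" by presburger
    then have "v \<in> {f (2 * (j div 2)), f (2 * (j div 2) + 1)}" using j by force
    moreover have "j div 2 < k" using j by simp
    ultimately show "v \<in> \<Union> (set (labelled k f))"
      unfolding labelled_def by fastforce
  qed
qed (auto simp: labelled_def)

lemma labelling_card_le: "labelling n k f \<Longrightarrow> 2 * k \<le> n"
  using card_inj_on_le[of f "{..<2 * k}" "{0..<n}"] by (auto simp: labelling_def)

lemma perfect_labelling_range: "labelling (2 * k) k f \<Longrightarrow> f ` {..<2 * k} = {0..<2 * k}"
  unfolding labelling_def by (intro card_subset_eq) (auto simp: card_image)

lemma finite_ordered_matchings: "finite (ordered_matchings k (complete_graph n))"
proof (rule finite_subset)
  show "ordered_matchings k (complete_graph n) \<subseteq> {L. set L \<subseteq> nsets {0..<n} 2 \<and> length L = k}"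
    by (auto simp: ordered_matchings_def matching_def complete_graph_def)
  show "finite {L. set L \<subseteq> nsets {0..<n} 2 \<and> length L = k}"
    by (intro finite_lists_length_eq finite_imp_finite_nsets) simp
qed

section \<open>Connectedness\<close>

lemma labelling_update:
  assumes "labelling n k f" "j < 2 * k" "v < n" "v \<notin> f ` {..<2 * k}"
  shows "labelling n k (f(j := v))"
  using assms by (auto simp: labelling_def inj_on_def)

text \<open>Casts a relabelling as the list update that \<open>replace_succ_rel\<close> expects.
  Writing both endpoints through \<open>f(j := v)\<close> avoids a case distinction on the parity of
  \<open>j\<close>.\<close>

lemma labelled_update:
  assumes "j < 2 * k"
  shows "labelled k (f(j := v)) =
    (labelled k f)[j div 2 := {(f(j := v)) (2 * (j div 2)), (f(j := v)) (2 * (j div 2) + 1)}]"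
proof (rule nth_equalityI)
  fix i assume "i < length (labelled k (f(j := v)))"
  then show "labelled k (f(j := v)) ! i =
    (labelled k f)[j div 2 := {(f(j := v)) (2 * (j div 2)), (f(j := v)) (2 * (j div 2) + 1)}] ! i"
    by (cases "i = j div 2") (auto simp: nth_list_update)
qed simp

lemma labelled_update_succ_rel:
  assumes "labelling n k f" "j < 2 * k" "v < n" "v \<notin> f ` {..<2 * k}"
  shows "(labelled k f, labelled k (f(j := v))) \<in> (succ_rel k (complete_graph n))\<^sup>*"
proof -
  have "labelled k f \<in> ordered_matchings k (complete_graph n)"
    "labelled k (f(j := v)) \<in> ordered_matchings k (complete_graph n)"
    using assms labelling_update ordered_matchings_complete_graph by blast+
  moreover have "j div 2 < k" using assms(2) by simp
  ultimately show ?thesis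
    unfolding labelled_update[OF assms(2)] by (intro replace_succ_rel)
qed

text \<open>Induction on the number of positions where \<open>f\<close> and \<open>g\<close>
  disagree.\<close>

lemma labelled_succ_rel:
  assumes n: "2 * k < n" and g: "labelling n k g" and f: "labelling n k f"
  shows "(labelled k f, labelled k g) \<in> (succ_rel k (complete_graph n))\<^sup>*"
  using f
proof (induction "card {j. j < 2 * k \<and> f j \<noteq> g j}" arbitrary: f rule: less_induct)
  case less
  let ?R = "(succ_rel k (complete_graph n))\<^sup>*"
  let ?D = "\<lambda>f. {j. j < 2 * k \<and> f j \<noteq> g j}"
  note f = \<open>labelling n k f\<close>
  have g_less: "g j < n" if "j < 2 * k" for j
    using g that by (auto simp: labelling_def)
  \<comment> \<open>If the label wanted at \<open>j\<close> is free, putting it there removes one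
    disagreement. The claim is about any \<open>f'\<close> with the same disagreements as
    \<open>f\<close>, to allow one preparatory move.\<close>
  have place: "(labelled k f', labelled k g) \<in> ?R"
    if f': "labelling n k f'" and j: "j < 2 * k" "g j \<notin> f' ` {..<2 * k}" and D: "?D f' = ?D f" for f' j
  proof -
    have "j \<in> ?D f'" using j by (metis (mono_tags, lifting) imageI lessThan_iff mem_Collect_eq)
    then have "?D (f'(j := g j)) \<subset> ?D f" using D by auto
    then have "card (?D (f'(j := g j))) < card (?D f)" by (intro psubset_card_mono) auto
    then have "(labelled k (f'(j := g j)), labelled k g) \<in> ?R"
      using less.hyps labelling_update[OF f' j(1) g_less j(2)] j(1) by blast
    moreover have "(labelled k f', labelled k (f'(j := g j))) \<in> ?R"
      using labelled_update_succ_rel[OF f' j(1) g_less j(2)] j(1) by blast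
    ultimately show ?thesis by (metis rtrancl_trans)
  qed
  show ?case
  proof (cases "g ` {..<2 * k} \<subseteq> f ` {..<2 * k}")
    case False
    then show ?thesis using place[OF f] by auto
  next
    case sub: True
    show ?thesis
    proof (cases "?D f = {}")
      case True
      then have "labelled k f = labelled k g" by (intro nth_equalityI) auto
      then show ?thesis by simp
    next
      case False
      then obtain j where j: "j < 2 * k" "f j \<noteq> g j" by auto
      have inj: "inj_on f {..<2 * k}" "inj_on g {..<2 * k}"
        using f g by (auto simp: labelling_def)
      then have range: "g ` {..<2 * k} = f ` {..<2 * k}"
        using sub by (intro card_subset_eq) (auto simp: card_image)
      have "\<not> {0..<n} \<subseteq> f ` {..<2 * k}"
      proof
        assume "{0..<n} \<subseteq> f ` {..<2 * k}"
        then have "card {0..<n} \<le> card (f ` {..<2 * k})" by (intro card_mono) auto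
        then show False using n inj by (simp add: card_image)
      qed
      then obtain v where "v \<in> {0..<n}" and "v \<notin> f ` {..<2 * k}" by blast
      then have v: "v < n" "v \<notin> f ` {..<2 * k}" by simp_all
      have "f j \<in> g ` {..<2 * k}" using range j(1) by simp
      then obtain m where m: "m < 2 * k" "g m = f j" by fastforce
      have "f m \<noteq> f j" using j m inj by (metis inj_onD lessThan_iff)
      have "g m \<notin> (f(j := v)) ` {..<2 * k}"
        using m j v inj by (auto simp: inj_on_def)
      \<comment> \<open>\<open>v\<close> lies outside the common range of \<open>f\<close> and
        \<open>g\<close>, so \<open>j\<close> is still wrong.\<close>
      moreover have "?D (f(j := v)) = ?D f"
        using j v range by auto
      ultimately have "(labelled k (f(j := v)), labelled k g) \<in> ?R"
        using place[OF labelling_update[OF f j(1) v] m(1)] by simp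
      then show ?thesis
        using labelled_update_succ_rel[OF f j(1) v] by (metis rtrancl_trans)
    qed
  qed
qed

lemma universal_cycle_complete_graph:
  assumes "k \<ge> 1" "k = 1 \<or> 2 * k \<noteq> n"
  shows "\<exists>c. universal_cycle k (complete_graph n) c"
proof (cases "ordered_matchings k (complete_graph n) = {}")
  case True
  then have "universal_cycle k (complete_graph n) []" by (simp add: universal_cycle_def)
  then show ?thesis ..
next
  case False
  show ?thesis
  proof (rule universal_cycle_if_connected[OF finite_ordered_matchings assms(1) False])
    fix L M assume LM: "L \<in> ordered_matchings k (complete_graph n)"
      "M \<in> ordered_matchings k (complete_graph n)"
    then obtain f g where fg: "labelling n k f" "L = labelled k f" "labelling n k g" "M = labelled k g"
      using ordered_matchings_complete_graph by metis
    show "(L, M) \<in> (succ_rel k (complete_graph n))\<^sup>*"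
    proof (cases "k = 1")
      case True
      \<comment> \<open>Both sides are empty, so any two single edges are adjacent. This covers
        \<open>n = 2\<close>, where no spare vertex exists.\<close>
      then have "tl L = butlast M" using fg by (simp add: labelled_def)
      then show ?thesis using LM by (auto simp: succ_rel_def)
    next
      case False
      then have "2 * k < n" using assms(2) labelling_card_le[OF fg(1)] by simp
      then show ?thesis using labelled_succ_rel fg by metis
    qed
  qed
qed

section \<open>Perfect matchings\<close>

text \<open>Both matchings cover all vertices, so \<open>a\<close> and \<open>b\<close> are each the
  complement of what \<open>w\<close> covers.\<close>

lemma perfect_forced:
  assumes "a # w \<in> ordered_matchings k (complete_graph (2 * k))"
    and "w @ [b] \<in> ordered_matchings k (complete_graph (2 * k))"
  shows "a = b"
proof -
  have "\<Union> (set L) = {0..<2 * k}" if "L \<in> ordered_matchings k (complete_graph (2 * k))" for L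
    using that by (metis Union_labelled ordered_matchings_complete_graph perfect_labelling_range)
  then have "a \<union> \<Union> (set w) = b \<union> \<Union> (set w)"
    using assms by (metis Sup_insert list.set Un_insert_right set_append sup_bot_right)
  moreover have "a \<inter> \<Union> (set w) = {}" "b \<inter> \<Union> (set w) = {}"
    using assms by (fastforce simp: ordered_matchings_def matching_def pairwise_insert disjnt_def)+
  ultimately show ?thesis by blast
qed

lemma no_universal_cycle_perfect:
  assumes "k \<ge> 2"
  shows "\<not> universal_cycle k (complete_graph (2 * k)) c"
proof
  let ?S = "ordered_matchings k (complete_graph (2 * k))"
  let ?N = "length c"
  let ?W = "cyclic_window c k"
  assume cycle: "universal_cycle k (complete_graph (2 * k)) c"
  then have card: "?N = card ?S" by (simp add: universal_cycle_def)
  have ex1: "\<forall>L \<in> ?S. \<exists>!i. i < ?N \<and> ?W i = L"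
    using cycle unfolding universal_cycle_def by (elim conjE)
  have ex: "\<exists>i<?N. ?W i = L" if "L \<in> ?S" for L
    by (rule ex1_implies_ex[OF bspec[OF ex1 that]])
  \<comment> \<open>The definition only makes every matching a window; as there are no more windows
    than matchings, every window is a matching.\<close>
  have "?S \<subseteq> ?W ` {..<?N}" using ex by fastforce
  moreover have "card (?W ` {..<?N}) \<le> card ?S"
    using card card_image_le[of "{..<?N}" ?W] by simp
  ultimately have windows: "?W ` {..<?N} = ?S"
    by (metis card_seteq finite_imageI finite_lessThan)
  obtain l where k: "k = Suc l" using assms by (cases k) auto
  \<comment> \<open>Neighbouring windows share the \<open>l\<close> edges of \<open>w\<close>, so
    the edge that leaves equals the edge that enters.\<close>
  have const: "set (?W i) = set (?W 0)" if "i < ?N" for i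
    using that
  proof (induction i)
    case (Suc i)
    define w where "w = map (\<lambda>j. c ! ((Suc i + j) mod ?N)) [0..<l]"
    have "?W i = c ! (i mod ?N) # w"
      by (simp add: k cyclic_window_def w_def map_upt_Suc del: upt_Suc)
    moreover have "?W (Suc i) = w @ [c ! ((Suc i + l) mod ?N)]"
      by (simp add: k cyclic_window_def w_def)
    moreover have "?W i \<in> ?S" "?W (Suc i) \<in> ?S"
      using Suc.prems windows by auto
    ultimately have "set (?W (Suc i)) = set (?W i)"
      using perfect_forced by fastforce
    then show ?case using Suc by simp
  qed simp
  \<comment> \<open>Two perfect matchings with different edge sets: one begins with
    \<open>{0, 1}\<close>, \<open>{2, 3}\<close>, the other with \<open>{0, 2}\<close>,
    \<open>{1, 3}\<close>.\<close>
  have id: "labelling (2 * k) k id" by (auto simp: labelling_def)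
  moreover have swap: "labelling (2 * k) k (id(1 := 2, 2 := 1))"
    using assms by (auto simp: labelling_def inj_on_def split: if_splits)
  ultimately have "labelled k id \<in> ?S" "labelled k (id(1 := 2, 2 := 1)) \<in> ?S"
    using ordered_matchings_complete_graph by blast+
  then have "set (labelled k id) = set (labelled k (id(1 := 2, 2 := 1)))"
    using ex const by metis
  moreover have "{0, 2} \<in> set (labelled k (id(1 := 2, 2 := 1)))"
    using assms nth_mem[of 0 "labelled k (id(1 := 2, 2 := 1 :: nat))"] by simp
  ultimately have "{0, 2} \<in> set (labelled k id)" by (rule ssubst)
  then obtain i :: nat where "{0, 2} = {2 * i, 2 * i + 1}" by (auto simp: labelled_def)
  then show False by (auto simp: doubleton_eq_iff)
qed

theorem theorem4:
  fixes n k :: nat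
  assumes "n \<ge> 1" and "k \<ge> 1"
  shows "(\<exists>c. universal_cycle k (complete_graph n) c) \<longleftrightarrow>
         \<not> (n \<ge> 4 \<and> even n \<and> k = n div 2)"
proof (cases "n \<ge> 4 \<and> even n \<and> k = n div 2")
  case True
  then have "n = 2 * k" "k \<ge> 2" by auto
  then show ?thesis using no_universal_cycle_perfect[of k] True by metis
next
  case False
  \<comment> \<open>If \<open>2 * k = n\<close>, the failing condition leaves only
    \<open>n < 4\<close>, hence \<open>k = 1\<close>.\<close>
  then have "k = 1 \<or> 2 * k \<noteq> n" using assms by auto
  then show ?thesis using universal_cycle_complete_graph assms(2) False by blast
qed

end
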